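(* Let $\mathcal{F}$ be a foliation of Euclidean space $\mathbb{R}^{n+1}$ by entire graphs. If the second fundamental form of the foliation $\mathcal{F}$ with respect to the upward-pointing unit normal vector field $N$ is nonnegative and $N$ converges to a fixed vector $\xi$ at infinity, then each leaf of $\mathcal{F}$ is a hyperplane orthogonal to $\xi$.
   Context: An entire graph is a hypersurface $\{(x,u(x)):x\in\mathbb{R}^n\}\subset\mathbb{R}^{n+1}$ with $u:\mathbb{R}^n\to\mathbb{R}$ smooth. The upward-pointing unit normal field $N$ is the unit normal field to the leaves with positive last coordinate. The second fundamental form of a leaf with respect to $N$ is $A(Y)=-\overline{\nabla}_YN$ for $Y$ tangent to the leaf, where $\overline{\nabla}$ is the flat connection of $\mathbb{R}^{n+1}$; it is nonnegative if $\langle A(Y),Y\rangle\ge0$ for all $Y$ tangent to the leaves. $N$ converges to the fixed vector $\xi$ at infinity if the angle between $N(p)$ and the (unit, parallel) vector $\xi$ tends to $0$ as $p$ tends to infinity in $\mathbb{R}^{n+1}$. *)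

theory Defs
  imports "HOL-Analysis.Analysis"
begin

text \<open>
  Throughout, \<open>\<real>\<^sup>n\<^sup>+\<^sup>1\<close> is \<open>(real ^ 'n) \<times> real\<close> with \<open>n = CARD('n)\<close>; the inner product and the norm of
  the product type are the Euclidean ones, and \<open>snd\<close> is the last coordinate.
\<close>

text \<open>Class \<open>C\<^sup>k\<close>, by differentiating in all directions; meant for open \<open>S\<close>.\<close>

primrec Ck_on :: "nat \<Rightarrow> 'a::real_normed_vector set \<Rightarrow> ('a \<Rightarrow> 'b::real_normed_vector) \<Rightarrow> bool" where
  "Ck_on 0 S f \<longleftrightarrow> continuous_on S f"
| "Ck_on (Suc k) S f \<longleftrightarrow>
     (\<forall>x\<in>S. f differentiable (at x)) \<and> (\<forall>v. Ck_on k S (\<lambda>x. frechet_derivative f (at x) v))"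

definition smooth_on :: "'a::real_normed_vector set \<Rightarrow> ('a \<Rightarrow> 'b::real_normed_vector) \<Rightarrow> bool" where
  "smooth_on S f \<longleftrightarrow> (\<forall>k. Ck_on k S f)"

text \<open>
  A foliated chart is a diffeomorphism of the open set \<open>U\<close> onto \<open>\<real>\<^sup>n \<times> \<real>\<close>, such that each leaf meets
  \<open>U\<close> in plaques, i.e. in level sets of the last coordinate of the chart.
\<close>

definition foliated_chart ::
    "('a::euclidean_space \<times> real) set set \<Rightarrow> ('a \<times> real) set \<Rightarrow> ('a \<times> real \<Rightarrow> 'a \<times> real) \<Rightarrow> bool" where
  "foliated_chart \<F> U \<phi> \<longleftrightarrow>
     open U \<and> bij_betw \<phi> U UNIV \<and> smooth_on U \<phi> \<and> smooth_on UNIV (inv_into U \<phi>) \<and>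
     (\<forall>L\<in>\<F>. \<forall>C\<in>components (L \<inter> U). \<exists>c. C = {p \<in> U. snd (\<phi> p) = c})"

text \<open>
  Smooth codimension-one foliations, as decompositions into leaves. The subspace topology suffices:
  a leaf meets a chart in at most countably many plaques, so the components of \<open>L \<inter> U\<close> are the same
  in the subspace and in the leaf topology, and so are the paths in \<open>L\<close>. Mere connectedness in the
  subspace topology would be too weak: it allows unions of several leaves that accumulate on
  one another.
\<close>

definition foliation :: "('a::euclidean_space \<times> real) set set \<Rightarrow> bool" where
  "foliation \<F> \<longleftrightarrow>
     partition_on UNIV \<F> \<and> (\<forall>L\<in>\<F>. path_connected L) \<and>
     (\<forall>p. \<exists>U \<phi>. p \<in> U \<and> foliated_chart \<F> U \<phi>)"

definition entire_graph :: "('a::euclidean_space \<times> real) set \<Rightarrow> bool" where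
  "entire_graph L \<longleftrightarrow> (\<exists>u. smooth_on UNIV u \<and> L = {(x, u x) |x. True})"

definition tangent_space :: "'v::real_normed_vector set \<Rightarrow> 'v \<Rightarrow> 'v set" where
  "tangent_space L p =
     {v. \<exists>e>0. \<exists>\<gamma>. smooth_on {-e<..<e} \<gamma> \<and> \<gamma> ` {-e<..<e} \<subseteq> L \<and> \<gamma> 0 = p \<and>
           (\<gamma> has_vector_derivative v) (at (0::real))}"

definition upward_unit_normal ::
    "('a::euclidean_space \<times> real) set set \<Rightarrow> ('a \<times> real \<Rightarrow> 'a \<times> real) \<Rightarrow> bool" where
  "upward_unit_normal \<F> N \<longleftrightarrow>
     (\<forall>L\<in>\<F>. \<forall>p\<in>L. norm (N p) = 1 \<and> (\<forall>Y\<in>tangent_space L p. N p \<bullet> Y = 0) \<and> snd (N p) > 0)"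

text \<open>
  \<open>A(Y) = - \<nabla>\<^sub>Y N\<close> at \<open>p\<close>; the flat connection is the ordinary derivative of vector-valued functions.
\<close>

definition second_fundamental_form :: "('v::euclidean_space \<Rightarrow> 'v) \<Rightarrow> 'v \<Rightarrow> 'v \<Rightarrow> 'v" where
  "second_fundamental_form N p Y = - frechet_derivative N (at p) Y"

definition nonneg_second_fundamental_form ::
    "('v::euclidean_space) set set \<Rightarrow> ('v \<Rightarrow> 'v) \<Rightarrow> bool" where
  "nonneg_second_fundamental_form \<F> N \<longleftrightarrow>
     (\<forall>L\<in>\<F>. \<forall>p\<in>L. \<forall>Y\<in>tangent_space L p. second_fundamental_form N p Y \<bullet> Y \<ge> 0)"

definition vec_angle :: "'v::real_inner \<Rightarrow> 'v \<Rightarrow> real" where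
  "vec_angle v w = arccos (v \<bullet> w / (norm v * norm w))"

definition converges_at_infinity_to :: "('v::euclidean_space \<Rightarrow> 'v) \<Rightarrow> 'v \<Rightarrow> bool" where
  "converges_at_infinity_to N \<xi> \<longleftrightarrow> ((\<lambda>p. vec_angle (N p) \<xi>) \<longlongrightarrow> 0) at_infinity"

definition hyperplane_orthogonal_to :: "'v::euclidean_space set \<Rightarrow> 'v \<Rightarrow> bool" where
  "hyperplane_orthogonal_to H \<xi> \<longleftrightarrow> \<xi> \<noteq> 0 \<and> (\<exists>c. H = {p. \<xi> \<bullet> p = c})"

end

theory Submission
  imports Defs
begin

text \<open>
  The leaves of a foliated chart are locally the level sets of a smooth function \<open>f\<close> without critical
  points, so \<open>N = \<plusminus> grad f / |grad f|\<close> is differentiable. Along the lift \<open>(x + t v, u (x + t v))\<close> of a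
  line to a leaf, orthogonality of \<open>N\<close> and the velocity expresses the slope of the lift through \<open>N\<close>,
  and nonnegativity of the second fundamental form makes this slope nondecreasing. Letting
  \<open>t \<rightarrow> \<infinity>\<close> gives \<open>\<xi> \<bullet> Y \<le> 0\<close> for every tangent vector \<open>Y\<close> at \<open>x\<close>. Since \<open>- Y\<close> is tangent as well, \<open>\<xi>\<close> is
  normal to the leaf, on which \<open>p \<mapsto> \<xi> \<bullet> p\<close> is therefore constant.
\<close>

section \<open>Smoothness of pairs and along lines, and tangent vectors of graphs\<close>

lemma Ck_on_const: "Ck_on k S (\<lambda>_. c)"
  by (induction k arbitrary: c) auto

lemma smooth_on_ident: "smooth_on UNIV (\<lambda>x. x)"
proof -
  have "Ck_on k UNIV (\<lambda>x :: 'a. x)" for k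
    by (cases k) (auto simp: Ck_on_const)
  then show ?thesis
    by (simp add: smooth_on_def)
qed

lemma smooth_on_imp_differentiable:
  assumes "smooth_on S f" and "x \<in> S"
  shows "f differentiable (at x)"
  using assms unfolding smooth_on_def by (auto dest: spec[of _ "Suc 0"])

lemma smooth_on_imp_differentiable_derivative:
  assumes "smooth_on S f" and "x \<in> S"
  shows "(\<lambda>x. frechet_derivative f (at x) v) differentiable (at x)"
proof -
  have "Ck_on (Suc (Suc 0)) S f"
    using assms(1) by (simp add: smooth_on_def)
  then show ?thesis
    using assms(2) by simp
qed

lemma Ck_on_Pair:
  assumes "Ck_on k UNIV f" and "Ck_on k UNIV g"
  shows "Ck_on k UNIV (\<lambda>x. (f x, g x))"
  using assms
proof (induction k arbitrary: f g)
  case 0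
  then show ?case
    by (auto intro: continuous_on_Pair)
next
  case (Suc k)
  have D: "((\<lambda>x. (f x, g x)) has_derivative
      (\<lambda>v. (frechet_derivative f (at x) v, frechet_derivative g (at x) v))) (at x)" for x
    using Suc.prems by (auto intro!: has_derivative_Pair simp: frechet_derivative_works[symmetric])
  have "frechet_derivative (\<lambda>x. (f x, g x)) (at x) =
      (\<lambda>v. (frechet_derivative f (at x) v, frechet_derivative g (at x) v))" for x
    using frechet_derivative_at[OF D] by simp
  then show ?case
    using Suc differentiableI[OF D] by simp
qed

lemma smooth_on_Pair:
  assumes "smooth_on UNIV f" and "smooth_on UNIV g"
  shows "smooth_on UNIV (\<lambda>x. (f x, g x))"
  using assms by (simp add: smooth_on_def Ck_on_Pair)

lemma has_derivative_along_line:
  assumes "f differentiable (at (a + t *\<^sub>R b))"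
  shows "((\<lambda>t. f (a + t *\<^sub>R b)) has_derivative
    (\<lambda>s. frechet_derivative f (at (a + t *\<^sub>R b)) (s *\<^sub>R b))) (at t)"
proof -
  have "((\<lambda>t. a + t *\<^sub>R b) has_derivative (\<lambda>s. s *\<^sub>R b)) (at t)"
    by (auto intro!: derivative_eq_intros)
  from has_derivative_compose[OF this] assms show ?thesis
    by (simp add: frechet_derivative_works)
qed

text \<open>The derivative of \<open>f\<close> along the line in direction \<open>s\<close> is a
  directional derivative of \<open>f\<close>, again restricted to the same line, so the induction
  closes for all \<open>f\<close> at once.\<close>

lemma Ck_on_along_line:
  assumes "Ck_on k UNIV f"
  shows "Ck_on k S (\<lambda>t. f (a + t *\<^sub>R b))"
  using assms
proof (induction k arbitrary: f)
  case 0
  have "continuous_on S (\<lambda>t. a + t *\<^sub>R b)"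
    by (intro continuous_intros)
  with 0 show ?case
    by (auto intro: continuous_on_compose2)
next
  case (Suc k)
  have D: "((\<lambda>t. f (a + t *\<^sub>R b)) has_derivative
      (\<lambda>s. frechet_derivative f (at (a + t *\<^sub>R b)) (s *\<^sub>R b))) (at t)" for t
    using Suc.prems by (intro has_derivative_along_line) auto
  have "frechet_derivative (\<lambda>t. f (a + t *\<^sub>R b)) (at t) =
      (\<lambda>s. frechet_derivative f (at (a + t *\<^sub>R b)) (s *\<^sub>R b))" for t
    using frechet_derivative_at[OF D] by simp
  moreover have "Ck_on k S (\<lambda>t. frechet_derivative f (at (a + t *\<^sub>R b)) (s *\<^sub>R b))" for s
    using Suc by auto
  ultimately show ?case
    using D by (auto simp: differentiable_def)
qed

text \<open>The image under \<open>f\<close> of the line through \<open>a\<close> is the witnessing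
  curve. This serves both the parametrization of a graph and the inverse of a foliated
  chart.\<close>

lemma tangent_space_along_line:
  assumes "smooth_on UNIV f" and "\<And>t. f (a + t *\<^sub>R b) \<in> L"
  shows "frechet_derivative f (at a) b \<in> tangent_space L (f a)"
proof -
  have d: "f differentiable (at a)"
    using smooth_on_imp_differentiable[OF assms(1)] by simp
  then have "((\<lambda>t. f (a + t *\<^sub>R b)) has_derivative
      (\<lambda>s. frechet_derivative f (at a) (s *\<^sub>R b))) (at 0)"
    using has_derivative_along_line[of f a 0 b] by simp
  then have "((\<lambda>t. f (a + t *\<^sub>R b)) has_vector_derivative frechet_derivative f (at a) b) (at 0)"
    using linear_frechet_derivative[OF d]
    by (simp add: has_vector_derivative_def linear_cmul)
  moreover have "smooth_on {-1<..<1} (\<lambda>t. f (a + t *\<^sub>R b))"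
    using assms(1) by (simp add: smooth_on_def Ck_on_along_line)
  ultimately show ?thesis
    unfolding tangent_space_def using assms(2)
    by (intro CollectI exI[of _ 1] conjI exI[of _ "\<lambda>t. f (a + t *\<^sub>R b)"]) auto
qed

lemma tangent_space_graph:
  assumes "smooth_on UNIV u"
  shows "(v, frechet_derivative u (at x) v) \<in> tangent_space {(x, u x) |x. True} (x, u x)"
proof -
  have "u differentiable (at x)"
    using smooth_on_imp_differentiable[OF assms] by simp
  then have "((\<lambda>x. (x, u x)) has_derivative (\<lambda>v. (v, frechet_derivative u (at x) v))) (at x)"
    by (auto intro!: has_derivative_Pair simp: frechet_derivative_works[symmetric])
  from frechet_derivative_at[OF this] show ?thesis
    using tangent_space_along_line[OF smooth_on_Pair[OF smooth_on_ident assms],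
        of x v "{(x, u x) |x. True}"]
    by (metis (mono_tags, lifting) mem_Collect_eq)
qed

section \<open>Differentiability of the normal field\<close>

text \<open>The component \<open>v\<close> of \<open>w\<close> orthogonal to \<open>g\<close> is
  orthogonal to \<open>w\<close> too, hence to itself, so it vanishes. Unit length and the sign of
  the last coordinate then fix the factor.\<close>

lemma parallel_if_orthogonal_complement:
  fixes g w :: "'a::euclidean_space \<times> real"
  assumes orth: "\<And>v. g \<bullet> v = 0 \<Longrightarrow> w \<bullet> v = 0" and "g \<noteq> 0" and "norm w = 1" and "snd w > 0"
  shows "snd g \<noteq> 0" and "w = (sgn (snd g) / norm g) *\<^sub>R g"
proof -
  define c where "c = (w \<bullet> g) / (g \<bullet> g)"
  define v where "v = w - c *\<^sub>R g"
  have gv: "g \<bullet> v = 0"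
    using \<open>g \<noteq> 0\<close> by (simp add: v_def c_def inner_diff_right inner_commute)
  have "v \<bullet> v = w \<bullet> v - c * (g \<bullet> v)"
    by (simp add: v_def inner_diff_left)
  then have "v = 0"
    using gv orth[OF gv] by simp
  then have w: "w = c *\<^sub>R g"
    by (simp add: v_def)
  have pos: "c * snd g > 0"
    using \<open>snd w > 0\<close> w by simp
  then show "snd g \<noteq> 0"
    by auto
  have "\<bar>c\<bar> * norm g = 1"
    using \<open>norm w = 1\<close> w by simp
  moreover have "sgn (snd g) = sgn c"
    using pos by (auto simp: zero_less_mult_iff)
  ultimately have "c = sgn (snd g) / norm g"
    using \<open>g \<noteq> 0\<close> by (auto simp: field_simps sgn_if abs_if split: if_splits)
  then show "w = (sgn (snd g) / norm g) *\<^sub>R g"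
    using w by simp
qed

text \<open>The component of \<open>L \<inter> U\<close> containing \<open>q\<close> is a level set,
  and \<open>q\<close> determines its level.\<close>

lemma foliated_chart_level_set_subset_leaf:
  assumes "foliated_chart \<F> U \<phi>" and "L \<in> \<F>" and "q \<in> L" and "q \<in> U"
  shows "{p \<in> U. snd (\<phi> p) = snd (\<phi> q)} \<subseteq> L"
proof -
  obtain C where C: "C \<in> components (L \<inter> U)" "q \<in> C"
    using assms(3,4) Union_components[of "L \<inter> U"] by blast
  then obtain c where "C = {p \<in> U. snd (\<phi> p) = c}"
    using assms(1,2) unfolding foliated_chart_def by blast
  then show ?thesis
    using C in_components_subset[OF C(1)] by auto
qed

text \<open>Chain rule for an identity that holds near \<open>x\<close>. It is applied to a chart
  and its inverse in both orders.\<close>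

lemma frechet_derivative_eq_id_of_left_inverse:
  assumes "f differentiable (at x)" and "g differentiable (at (f x))"
    and "open U" and "x \<in> U" and "\<And>y. y \<in> U \<Longrightarrow> g (f y) = y"
  shows "frechet_derivative g (at (f x)) (frechet_derivative f (at x) v) = v"
proof -
  have "((\<lambda>y. g (f y)) has_derivative
      (\<lambda>v. frechet_derivative g (at (f x)) (frechet_derivative f (at x) v))) (at x)"
    using assms(1,2) has_derivative_compose by (auto simp: frechet_derivative_works)
  then have "((\<lambda>y. y) has_derivative
      (\<lambda>v. frechet_derivative g (at (f x)) (frechet_derivative f (at x) v))) (at x)"
    using has_derivative_transform_within_open assms(3-5) by fastforce
  then show ?thesis
    using has_derivative_unique[OF _ has_derivative_ident] by metis
qed

text \<open>\<open>second_fundamental_form\<close> is built on \<open>frechet_derivative\<close>,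
  which is meaningful only where \<open>N\<close> is differentiable. The charts supply this
  regularity.\<close>

lemma upward_unit_normal_differentiable:
  fixes \<F> :: "('a::euclidean_space \<times> real) set set"
  assumes fol: "foliation \<F>" and N: "upward_unit_normal \<F> N"
  shows "N differentiable (at p)"
proof -
  obtain U \<phi> where pU: "p \<in> U" and chart: "foliated_chart \<F> U \<phi>"
    using fol unfolding foliation_def by blast
  define \<psi> where "\<psi> = inv_into U \<phi>"
  have U: "open U" and bij: "bij_betw \<phi> U UNIV" and \<phi>: "smooth_on U \<phi>" and \<psi>: "smooth_on UNIV \<psi>"
    using chart by (auto simp: foliated_chart_def \<psi>_def)
  have \<psi>\<phi>: "\<psi> (\<phi> y) = y" if "y \<in> U" for y
    using bij that by (auto simp: \<psi>_def bij_betw_def)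
  have \<phi>\<psi>: "\<phi> (\<psi> z) = z" and \<psi>U: "\<psi> z \<in> U" for z
    using bij by (auto simp: \<psi>_def bij_betw_def f_inv_into_f inv_into_into)
  note d\<phi> = smooth_on_imp_differentiable[OF \<phi>]
  have d\<psi>: "\<psi> differentiable (at z)" for z
    using smooth_on_imp_differentiable[OF \<psi>] by simp
  \<comment> \<open>On \<open>U\<close>, this is the gradient of the last coordinate of the chart.
    Its coefficients are directional derivatives of \<open>\<phi>\<close>, which are differentiable
    by smoothness.\<close>
  define G where "G q = (\<Sum>b\<in>Basis. snd (frechet_derivative \<phi> (at q) b) *\<^sub>R b)" for q
  have G: "G q \<bullet> v = snd (frechet_derivative \<phi> (at q) v)" if "q \<in> U" for q v
  proof -
    have "linear (\<lambda>v. snd (frechet_derivative \<phi> (at q) v))"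
      using linear_compose[OF linear_frechet_derivative[OF d\<phi>[OF that]] linear_snd]
      by (simp add: o_def)
    from linear_sum[OF this, of "\<lambda>b. (v \<bullet> b) *\<^sub>R b" Basis] linear_cmul[OF this]
    have "snd (frechet_derivative \<phi> (at q) v) =
        (\<Sum>b\<in>Basis. (v \<bullet> b) * snd (frechet_derivative \<phi> (at q) b))"
      by (simp add: euclidean_representation)
    then show ?thesis
      by (simp add: G_def inner_sum_left inner_commute[of v] mult.commute)
  qed
  have G0: "G q \<noteq> 0" if "q \<in> U" for q
  proof -
    \<comment> \<open>The preimage of \<open>(0, 1)\<close> under the differential of the chart is a
      direction in which the last coordinate grows at rate 1.\<close>
    have "frechet_derivative \<phi> (at (\<psi> (\<phi> q))) (frechet_derivative \<psi> (at (\<phi> q)) (0, 1)) = (0, 1)"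
      using frechet_derivative_eq_id_of_left_inverse[of \<psi> "\<phi> q" \<phi> UNIV] d\<psi> d\<phi> \<psi>U \<phi>\<psi> by simp
    then have "G q \<bullet> frechet_derivative \<psi> (at (\<phi> q)) (0, 1) = 1"
      using that \<psi>\<phi> G by simp
    then show ?thesis
      by auto
  qed
  have Nq: "snd (G q) \<noteq> 0" "N q = (sgn (snd (G q)) / norm (G q)) *\<^sub>R G q" if q: "q \<in> U" for q
  proof -
    obtain L where L: "L \<in> \<F>" "q \<in> L"
      using fol unfolding foliation_def partition_on_def by blast
    have *: "N q \<bullet> v = 0" if v: "G q \<bullet> v = 0" for v
    proof -
      \<comment> \<open>Seen in the chart, \<open>v\<close> becomes \<open>b\<close>. As
        \<open>snd b = 0\<close>, the line in direction \<open>b\<close> stays in one plaque, and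
        \<open>\<psi>\<close> maps it to a curve in \<open>L\<close> with velocity
        \<open>v\<close>.\<close>
      define b where "b = frechet_derivative \<phi> (at q) v"
      have "snd b = 0"
        using v q G by (simp add: b_def)
      then have "\<psi> (\<phi> q + t *\<^sub>R b) \<in> L" for t
        using foliated_chart_level_set_subset_leaf[OF chart L q] by (auto simp del: split_paired_All simp: subset_eq \<psi>U \<phi>\<psi>)
      from tangent_space_along_line[OF \<psi> this]
      have "v \<in> tangent_space L q"
        using frechet_derivative_eq_id_of_left_inverse[OF d\<phi>[OF q] d\<psi> U q \<psi>\<phi>]
        by (simp add: b_def q \<psi>\<phi>)
      then show ?thesis
        using N L unfolding upward_unit_normal_def by blast
    qed
    have "norm (N q) = 1" "snd (N q) > 0"
      using N L unfolding upward_unit_normal_def by auto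
    with parallel_if_orthogonal_complement[OF _ G0[OF q], of "N q"] *
    show "snd (G q) \<noteq> 0" "N q = (sgn (snd (G q)) / norm (G q)) *\<^sub>R G q"
      by blast+
  qed
  have dG: "G differentiable (at q)" if q: "q \<in> U" for q
  proof -
    have "(\<lambda>q. snd (frechet_derivative \<phi> (at q) b)) differentiable (at q)" for b
    proof -
      obtain D where "((\<lambda>q. frechet_derivative \<phi> (at q) b) has_derivative D) (at q)"
        using smooth_on_imp_differentiable_derivative[OF \<phi> q] unfolding differentiable_def by blast
      from differentiableI[OF has_derivative_snd[OF this]] show ?thesis .
    qed
    then show ?thesis
      unfolding G_def[abs_def] by (intro differentiable_sum differentiable_scaleR) auto
  qed
  \<comment> \<open>By continuity the sign of \<open>snd (G q)\<close> is constant near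
    \<open>p\<close>, so the sign factor in the formula for \<open>N\<close> can be frozen
    there.\<close>
  define s where "s = sgn (snd (G p))"
  have "isCont (\<lambda>q. s * snd (G q)) p"
    using differentiable_imp_continuous_within[OF dG[OF pU]] by (intro continuous_intros) auto
  moreover have "s * snd (G p) > 0"
    using Nq(1)[OF pU] by (simp add: s_def sgn_if)
  ultimately have "\<forall>\<^sub>F q in nhds p. s * snd (G q) > 0"
    by (auto simp: isCont_def intro: tendsto_at_iff_tendsto_nhds[THEN iffD1] order_tendstoD)
  moreover have "\<forall>\<^sub>F q in nhds p. q \<in> U"
    using U pU by (rule eventually_nhds_in_open)
  ultimately have ev: "\<forall>\<^sub>F q in nhds p. (s / norm (G q)) *\<^sub>R G q = N q"
  proof eventually_elim
    case (elim q)
    then have "sgn (snd (G q)) = s"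
      by (auto simp: s_def sgn_if split: if_splits)
    then show ?case
      using Nq(2) elim by simp
  qed
  have "(\<lambda>q. (s / norm (G q)) *\<^sub>R G q) differentiable (at p)"
  proof -
    \<comment> \<open>The norm is differentiable away from 0, and \<open>G p\<close> is
      nonzero.\<close>
    have "(norm \<circ> G) differentiable (at p)"
      using G0[OF pU] dG[OF pU]
      by (intro differentiable_chain_at differentiable_norm_at) auto
    then show ?thesis
      using G0[OF pU] dG[OF pU]
      by (intro differentiable_scaleR differentiable_divide) (auto simp: o_def)
  qed
  then obtain D where "((\<lambda>q. (s / norm (G q)) *\<^sub>R G q) has_derivative D) (at p)"
    by (auto simp: differentiable_def)
  then have "(N has_derivative D) (at p)"
    using has_derivative_transform_eventually eventually_nhds_x_imp_x[OF ev]
      filter_leD[OF at_within_le_nhds ev] by blast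
  then show ?thesis
    by (auto simp: differentiable_def)
qed

section \<open>The normal along lifted lines and its limit\<close>

text \<open>For unit vectors the cosine of the angle is the inner product, and the squared distance
  is 2 minus twice that product.\<close>

lemma converges_at_infinity_imp_tendsto:
  fixes N :: "'v::euclidean_space \<Rightarrow> 'v"
  assumes "converges_at_infinity_to N \<xi>" and "\<And>p. norm (N p) = 1" and "norm \<xi> = 1"
  shows "(N \<longlongrightarrow> \<xi>) at_infinity"
proof -
  have c: "cos (vec_angle (N p) \<xi>) = N p \<bullet> \<xi>" for p
    using Cauchy_Schwarz_ineq2[of "N p" \<xi>] assms(2,3)
    by (simp add: vec_angle_def cos_arccos_abs)
  have "((\<lambda>p. cos (vec_angle (N p) \<xi>)) \<longlongrightarrow> cos 0) at_infinity"
    using assms(1) unfolding converges_at_infinity_to_def by (rule tendsto_cos)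
  then have "((\<lambda>p. N p \<bullet> \<xi>) \<longlongrightarrow> 1) at_infinity"
    by (simp add: c)
  then have "((\<lambda>p. sqrt (2 - 2 * (N p \<bullet> \<xi>))) \<longlongrightarrow> sqrt (2 - 2 * 1)) at_infinity"
    by (intro tendsto_intros)
  moreover have "norm (N p - \<xi>) = sqrt (2 - 2 * (N p \<bullet> \<xi>))" for p
  proof -
    have "N p \<bullet> N p = 1" "\<xi> \<bullet> \<xi> = 1"
      using assms(2,3) by (simp_all add: norm_eq_1)
    then show ?thesis
      by (simp add: norm_eq_sqrt_inner inner_diff inner_commute)
  qed
  ultimately have "((\<lambda>p. norm (N p - \<xi>)) \<longlongrightarrow> 0) at_infinity"
    by simp
  then show ?thesis
    using Lim_null tendsto_norm_zero_iff by blast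
qed

text \<open>
  With \<open>N = (P, q)\<close> along the lifted line, the slope is \<open>k = - (P \<bullet> v) / q\<close>, whose derivative is
  \<open>- (P' \<bullet> v + q' k) / q\<close>. Its numerator is the second fundamental form at the velocity \<open>(v, k)\<close>.
\<close>

lemma slope_along_line_mono:
  fixes u :: "'a::euclidean_space \<Rightarrow> real"
  assumes u: "\<And>x. u differentiable (at x)"
    and N: "\<And>x. N differentiable (at (x, u x))"
    and pos: "\<And>x. snd (N (x, u x)) > 0"
    and orth: "\<And>x v. N (x, u x) \<bullet> (v, frechet_derivative u (at x) v) = 0"
    and II: "\<And>x v. second_fundamental_form N (x, u x) (v, frechet_derivative u (at x) v)
                   \<bullet> (v, frechet_derivative u (at x) v) \<ge> 0"
    and "0 \<le> t"
  shows "frechet_derivative u (at x) v \<le> frechet_derivative u (at (x + t *\<^sub>R v)) v"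
proof -
  define k where "k t = frechet_derivative u (at (x + t *\<^sub>R v)) v" for t
  define \<gamma> where "\<gamma> t = (x + t *\<^sub>R v, u (x + t *\<^sub>R v))" for t
  define D where "D t = frechet_derivative N (at (\<gamma> t)) (v, k t)" for t
  have k: "k t = - (fst (N (\<gamma> t)) \<bullet> v) / snd (N (\<gamma> t))" for t
    using orth[of "x + t *\<^sub>R v" v] pos[of "x + t *\<^sub>R v"]
    by (simp add: k_def \<gamma>_def inner_prod_def field_simps)
  have "(\<gamma> has_derivative (\<lambda>s. s *\<^sub>R (v, k t))) (at t)" for t
  proof -
    have "((\<lambda>t. x + t *\<^sub>R v) has_derivative (\<lambda>s. s *\<^sub>R v)) (at t)"
      by (auto intro!: derivative_eq_intros)
    from has_derivative_Pair[OF this has_derivative_along_line[OF u, where a = x and t = t and b = v]]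
    show ?thesis
      using linear_cmul[OF linear_frechet_derivative[OF u]]
      by (simp add: \<gamma>_def[abs_def] k_def)
  qed
  then have "((\<lambda>t. N (\<gamma> t)) has_derivative
      (\<lambda>s. frechet_derivative N (at (\<gamma> t)) (s *\<^sub>R (v, k t)))) (at t)" for t
    using has_derivative_compose N unfolding frechet_derivative_works \<gamma>_def by blast
  moreover have "frechet_derivative N (at (\<gamma> t)) (s *\<^sub>R (v, k t)) = s *\<^sub>R D t" for s t
    using linear_cmul[OF linear_frechet_derivative[OF N]] unfolding \<gamma>_def D_def .
  ultimately have dN: "((\<lambda>t. N (\<gamma> t)) has_derivative (\<lambda>s. s *\<^sub>R D t)) (at t)" for t
    by simp
  have dq: "((\<lambda>t. snd (N (\<gamma> t))) has_real_derivative snd (D t)) (at t)" for t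
    using has_derivative_snd[OF dN]
    by (simp add: has_field_derivative_def mult_commute_abs)
  have dP: "((\<lambda>t. fst (N (\<gamma> t)) \<bullet> v) has_real_derivative fst (D t) \<bullet> v) (at t)" for t
    using has_derivative_inner_left[OF has_derivative_fst[OF dN], of v]
    by (simp add: has_field_derivative_def mult_commute_abs)
  have q0: "snd (N (\<gamma> t)) > 0" for t
    using pos by (simp add: \<gamma>_def)
  have dk: "(k has_real_derivative (- (fst (D t) \<bullet> v) - snd (D t) * k t) / snd (N (\<gamma> t))) (at t)" for t
  proof -
    have "((\<lambda>t. - (fst (N (\<gamma> t)) \<bullet> v) / snd (N (\<gamma> t))) has_real_derivative
        (- (fst (D t) \<bullet> v) * snd (N (\<gamma> t)) - - (fst (N (\<gamma> t)) \<bullet> v) * snd (D t))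
          / (snd (N (\<gamma> t)) * snd (N (\<gamma> t)))) (at t)"
      using q0[of t] by (intro DERIV_divide DERIV_minus dP dq) auto
    \<comment> \<open>One factor \<open>snd (N (\<gamma> t))\<close> cancels because
      \<open>fst (N (\<gamma> t)) \<bullet> v\<close> is \<open>- k t\<close> times it.\<close>
    moreover have "(- (fst (D t) \<bullet> v) * snd (N (\<gamma> t)) - - (fst (N (\<gamma> t)) \<bullet> v) * snd (D t))
          / (snd (N (\<gamma> t)) * snd (N (\<gamma> t))) = (- (fst (D t) \<bullet> v) - snd (D t) * k t) / snd (N (\<gamma> t))"
      using q0[of t] by (simp add: k field_simps)
    ultimately show ?thesis
      by (simp add: k[abs_def])
  qed
  have "(- (fst (D t) \<bullet> v) - snd (D t) * k t) / snd (N (\<gamma> t)) \<ge> 0" for t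
    using II[of "x + t *\<^sub>R v" v] q0[of t]
    by (simp add: second_fundamental_form_def D_def \<gamma>_def k_def inner_prod_def)
  then have "k 0 \<le> k t"
    using dk \<open>0 \<le> t\<close> DERIV_nonneg_imp_nondecreasing[of 0 t k] by blast
  then show ?thesis
    by (simp add: k_def)
qed

text \<open>Along the lifted line the velocity keeps its horizontal part \<open>v\<close> while its
  slope does not decrease. As \<open>N\<close> has positive last coordinate and annihilates the
  velocity, its product with the initial velocity is nonpositive, and so is the limit.\<close>

lemma limit_normal_inner_tangent_nonpos:
  fixes u :: "'a::euclidean_space \<Rightarrow> real"
  assumes u: "\<And>x. u differentiable (at x)"
    and N: "\<And>x. N differentiable (at (x, u x))"
    and pos: "\<And>x. snd (N (x, u x)) > 0"
    and orth: "\<And>x v. N (x, u x) \<bullet> (v, frechet_derivative u (at x) v) = 0"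
    and II: "\<And>x v. second_fundamental_form N (x, u x) (v, frechet_derivative u (at x) v)
                   \<bullet> (v, frechet_derivative u (at x) v) \<ge> 0"
    and lim: "(N \<longlongrightarrow> \<xi>) at_infinity"
  shows "\<xi> \<bullet> (v, frechet_derivative u (at x) v) \<le> 0"
\<comment> \<open>For \<open>v = 0\<close> the line does not leave the point \<open>x\<close>, but
  the tangent vector is zero.\<close>
proof (cases "v = 0")
  case True
  then show ?thesis
    using linear_0[OF linear_frechet_derivative[OF u]] by (simp add: inner_prod_def)
next
  case False
  define \<gamma> where "\<gamma> t = (x + t *\<^sub>R v, u (x + t *\<^sub>R v))" for t
  have "filterlim \<gamma> at_infinity at_top"
  proof -
    \<comment> \<open>The horizontal part alone forces the lifted line to infinity, whatever the
      values of \<open>u\<close>.\<close>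
    have "norm (\<gamma> t) \<ge> t * norm v - norm x" for t
    proof -
      have "t * norm v \<le> norm (t *\<^sub>R v)"
        by (simp add: mult_right_mono)
      also have "\<dots> \<le> norm (x + t *\<^sub>R v) + norm x"
        by (metis add_diff_cancel_left' norm_triangle_ineq4)
      also have "norm (x + t *\<^sub>R v) \<le> norm (\<gamma> t)"
        using norm_fst_le[of "fst (\<gamma> t)" "snd (\<gamma> t)"] by (simp add: \<gamma>_def)
      finally show ?thesis
        by simp
    qed
    moreover have "filterlim (\<lambda>t. t * norm v - norm x) at_top at_top"
    proof -
      have "filterlim (\<lambda>t. - norm x + norm v * t) at_top at_top"
        using False
        by (intro filterlim_tendsto_add_at_top[OF tendsto_const]
            filterlim_tendsto_pos_mult_at_top[OF tendsto_const] filterlim_ident) simp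
      then show ?thesis
        by (simp add: mult.commute)
    qed
    ultimately show ?thesis
      by (intro filterlim_norm_at_top_imp_at_infinity)
        (auto intro: filterlim_at_top_mono always_eventually)
  qed
  then have limN: "((\<lambda>t. N (\<gamma> t)) \<longlongrightarrow> \<xi>) at_top"
    using lim by (rule filterlim_compose[rotated])
  have "N (\<gamma> t) \<bullet> (v, frechet_derivative u (at x) v) \<le> 0" if "t \<ge> 0" for t
  proof -
    have "frechet_derivative u (at x) v \<le> frechet_derivative u (at (x + t *\<^sub>R v)) v"
      using slope_along_line_mono[OF u N pos orth II that] .
    then have "N (\<gamma> t) \<bullet> (v, frechet_derivative u (at x) v)
        \<le> N (\<gamma> t) \<bullet> (v, frechet_derivative u (at (x + t *\<^sub>R v)) v)"
      using pos[of "x + t *\<^sub>R v"] by (simp add: inner_prod_def \<gamma>_def)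
    then show ?thesis
      using orth by (simp add: \<gamma>_def)
  qed
  then have "\<forall>\<^sub>F t in at_top. N (\<gamma> t) \<bullet> (v, frechet_derivative u (at x) v) \<le> 0"
    using eventually_ge_at_top by (rule eventually_mono[rotated])
  then show ?thesis
    using tendsto_upperbound[OF tendsto_inner[OF limN tendsto_const]] by simp
qed

section \<open>From orthogonality to hyperplanes\<close>

text \<open>The height in direction \<open>\<xi>\<close> has zero derivative along the graph, so it
  is constant. Conversely, \<open>snd \<xi> \<noteq> 0\<close> lets the equation of the hyperplane
  be solved for the last coordinate.\<close>

lemma graph_orthogonal_imp_hyperplane:
  fixes u :: "'a::euclidean_space \<Rightarrow> real"
  assumes u: "\<And>x. u differentiable (at x)" and "\<xi> \<noteq> 0"
    and orth: "\<And>x v. \<xi> \<bullet> (v, frechet_derivative u (at x) v) = 0"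
  shows "hyperplane_orthogonal_to {(x, u x) |x. True} \<xi>"
proof -
  have q: "snd \<xi> \<noteq> 0"
  proof
    assume "snd \<xi> = 0"
    then have "fst \<xi> \<bullet> v = 0" for v
      using orth[of v 0] by (simp add: inner_prod_def)
    from this[of "fst \<xi>"] \<open>snd \<xi> = 0\<close> \<open>\<xi> \<noteq> 0\<close> show False
      by (simp add: prod_eq_iff)
  qed
  have "((\<lambda>x. \<xi> \<bullet> (x, u x)) has_derivative (\<lambda>v. 0)) (at x within UNIV)" for x
  proof -
    have "((\<lambda>x. \<xi> \<bullet> (x, u x)) has_derivative
        (\<lambda>v. \<xi> \<bullet> (v, frechet_derivative u (at x) v))) (at x)"
      using u
      by (intro has_derivative_inner_right has_derivative_Pair has_derivative_ident)
        (simp add: frechet_derivative_works[symmetric])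
    then show ?thesis
      by (simp add: orth)
  qed
  then obtain c where c: "\<xi> \<bullet> (x, u x) = c" for x
    using has_derivative_zero_constant[of UNIV "\<lambda>x. \<xi> \<bullet> (x, u x)"] by auto
  have "{(x, u x) |x. True} = {p. \<xi> \<bullet> p = c}"
  proof safe
    fix x
    show "\<xi> \<bullet> (x, u x) = c"
      by (rule c)
  next
    fix x y
    assume "c = \<xi> \<bullet> (x, y)"
    then show "\<exists>z. (x, y) = (z, u z) \<and> True"
      using c[of x] q by (simp add: inner_prod_def)
  qed
  then show ?thesis
    using \<open>\<xi> \<noteq> 0\<close> by (auto simp: hyperplane_orthogonal_to_def)
qed

theorem corollary4p4:
  fixes \<F> :: "((real ^ 'n) \<times> real) set set"
    and N :: "(real ^ 'n) \<times> real \<Rightarrow> (real ^ 'n) \<times> real"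
    and \<xi> :: "(real ^ 'n) \<times> real"
  assumes "foliation \<F>"
    and "\<forall>L\<in>\<F>. entire_graph L"
    and "upward_unit_normal \<F> N"
    and "nonneg_second_fundamental_form \<F> N"
    and "norm \<xi> = 1"
    and "converges_at_infinity_to N \<xi>"
  shows "\<forall>L\<in>\<F>. hyperplane_orthogonal_to L \<xi>"
proof
  fix L
  assume L: "L \<in> \<F>"
  then obtain u where u: "smooth_on UNIV u" and Lu: "L = {(x, u x) |x. True}"
    using assms(2) unfolding entire_graph_def by blast
  have inL: "(x, u x) \<in> L" for x
    using Lu by auto
  have du: "u differentiable (at x)" for x
    using smooth_on_imp_differentiable[OF u] by simp
  note dN = upward_unit_normal_differentiable[OF assms(1,3)]
  have tangent: "(v, frechet_derivative u (at x) v) \<in> tangent_space L (x, u x)" for x v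
    using tangent_space_graph[OF u] Lu by simp
  have pos: "snd (N (x, u x)) > 0"
    and orth: "N (x, u x) \<bullet> (v, frechet_derivative u (at x) v) = 0" for x v
    using assms(3) L inL tangent unfolding upward_unit_normal_def by blast+
  have II: "second_fundamental_form N (x, u x) (v, frechet_derivative u (at x) v)
      \<bullet> (v, frechet_derivative u (at x) v) \<ge> 0" for x v
    using assms(4) L inL tangent unfolding nonneg_second_fundamental_form_def by blast
  \<comment> \<open>The leaves cover the space, so \<open>N\<close> has unit length everywhere, as
    the passage from angles to vectors requires.\<close>
  have "\<Union>\<F> = UNIV"
    using assms(1) unfolding foliation_def partition_on_def by blast
  then have "norm (N p) = 1" for p
    using assms(3) unfolding upward_unit_normal_def by blast
  then have lim: "(N \<longlongrightarrow> \<xi>) at_infinity"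
    using converges_at_infinity_imp_tendsto assms(5,6) by blast
  have "\<xi> \<bullet> (v, frechet_derivative u (at x) v) = 0" for x v
  proof (rule antisym)
    note nonpos = limit_normal_inner_tangent_nonpos[OF du dN pos orth II lim]
    show "\<xi> \<bullet> (v, frechet_derivative u (at x) v) \<le> 0"
      by (rule nonpos)
    \<comment> \<open>Running the line backwards reverses the tangent vector and yields the opposite
      inequality.\<close>
    have "(- v, frechet_derivative u (at x) (- v)) = - (v, frechet_derivative u (at x) v)"
      using linear_neg[OF linear_frechet_derivative[OF du]] by simp
    then show "0 \<le> \<xi> \<bullet> (v, frechet_derivative u (at x) v)"
      using nonpos[of "- v" x] by (simp only: inner_minus_right)
  qed
  moreover have "\<xi> \<noteq> 0"
    using assms(5) by auto
  ultimately show "hyperplane_orthogonal_to L \<xi>"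
    unfolding Lu using graph_orthogonal_imp_hyperplane du by blast
qed

end
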